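(* There is an absolute constant $K>0$ such that for every $n\ge 1$ and every total Boolean function $f:\{0,1\}^n\to\{0,1\}$, $$\mathrm{EC}(f)\le R_0(f)\le K\cdot \mathrm{EC}(f)^2 .$$
   Context: Let $f:\{0,1\}^n\to\{0,1\}$ and $[n]=\{1,\dots,n\}$. Query model: a randomized query algorithm $\mathcal A$ is given query access to $x\in\{0,1\}^n$ and a random string $r$; with one query it learns one bit $x_i$ of its choice (adaptively), and finally it outputs a bit $\mathcal A(x,r)$. $C(\mathcal A,x,r)$ denotes the number of queries made on $x$ with randomness $r$. (Equivalently, a randomized algorithm is a probability distribution over deterministic decision trees.) The zero-error randomized query complexity is $R_0(f)=\min_{\mathcal A}\max_x \mathbb E_r[C(\mathcal A,x,r)]$, over randomized query algorithms $\mathcal A$ with $\Pr_r[\mathcal A(x,r)=f(x)]=1$ for all $x\in\{0,1\}^n$. The expectational certificate complexity $\mathrm{EC}(f)$ is the optimal value of the following program over families $\{w_x\}_{x\in\{0,1\}^n}$, $w_x\in\mathbb R^n$: minimize $\max_{x}\sum_{i=1}^n w_x(i)$ subject to $\sum_{i:x_i\ne y_i} w_x(i)w_y(i)\ge 1$ for all $x,y$ with $f(x)\ne f(y)$, and $0\le w_x(i)\le 1$ for all $x\in\{0,1\}^n$, $i\in[n]$. *)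

theory Defs
  imports "HOL-Probability.Probability"
begin

text \<open>
  An input in $\{0,1\}^n$ is a \<^typ>\<open>bool list\<close> of length \<open>n\<close>; the coordinate set $[n]$ is
  represented by the list positions \<open>{..<n}\<close>.  A Boolean function on $\{0,1\}^n$ is a function on
  all Boolean lists of which only the values on \<open>inputs n\<close> are ever used.
\<close>

definition inputs :: "nat \<Rightarrow> bool list set" where
  "inputs n = {x. length x = n}"


subsection \<open>Query complexity\<close>

text \<open>In \<open>Query i S T\<close>, the computation continues with \<open>S\<close> if the queried bit is 0 and with
  \<open>T\<close> if it is 1.\<close>

datatype dtree = Output bool | Query nat dtree dtree

primrec dtree_over :: "nat \<Rightarrow> dtree \<Rightarrow> bool" where
  "dtree_over n (Output b) \<longleftrightarrow> True"
| "dtree_over n (Query i S T) \<longleftrightarrow> i < n \<and> dtree_over n S \<and> dtree_over n T"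

primrec run :: "dtree \<Rightarrow> bool list \<Rightarrow> bool" where
  "run (Output b) x = b"
| "run (Query i S T) x = (if x ! i then run T x else run S x)"

primrec queries :: "dtree \<Rightarrow> bool list \<Rightarrow> nat" where
  "queries (Output b) x = 0"
| "queries (Query i S T) x = Suc (if x ! i then queries T x else queries S x)"

text \<open>
  A randomized query algorithm is a probability distribution over deterministic decision trees.
  As there are only countably many trees, every such distribution is a \<^typ>\<open>dtree pmf\<close>.
\<close>

definition rand_algs :: "nat \<Rightarrow> dtree pmf set" where
  "rand_algs n = {A. \<forall>T\<in>set_pmf A. dtree_over n T}"

definition zero_error :: "nat \<Rightarrow> (bool list \<Rightarrow> bool) \<Rightarrow> dtree pmf \<Rightarrow> bool" where
  "zero_error n f A \<longleftrightarrow> (\<forall>x\<in>inputs n. measure_pmf.prob A {T. run T x = f x} = 1)"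

text \<open>
  The depth of the trees in the support need not be bounded, so the expected number of queries may
  be infinite; hence it is taken in \<^typ>\<open>ennreal\<close> (a Bochner integral would be 0 in this case).
\<close>

definition expected_queries :: "dtree pmf \<Rightarrow> bool list \<Rightarrow> ennreal" where
  "expected_queries A x = (\<integral>\<^sup>+ T. of_nat (queries T x) \<partial>measure_pmf A)"

definition R0 :: "nat \<Rightarrow> (bool list \<Rightarrow> bool) \<Rightarrow> ennreal" where
  "R0 n f = (INF A\<in>{A\<in>rand_algs n. zero_error n f A}. SUP x\<in>inputs n. expected_queries A x)"


subsection \<open>Expectational certificate complexity\<close>

definition EC_feasible :: "nat \<Rightarrow> (bool list \<Rightarrow> bool) \<Rightarrow> (bool list \<Rightarrow> nat \<Rightarrow> real) \<Rightarrow> bool" where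
  "EC_feasible n f w \<longleftrightarrow>
     (\<forall>x\<in>inputs n. \<forall>y\<in>inputs n. f x \<noteq> f y \<longrightarrow>
        (\<Sum>i\<in>{i. i < n \<and> x ! i \<noteq> y ! i}. w x i * w y i) \<ge> 1) \<and>
     (\<forall>x\<in>inputs n. \<forall>i<n. 0 \<le> w x i \<and> w x i \<le> 1)"

text \<open>The infimum is over a nonempty set (all weights 1 are feasible) that is bounded below by 0.\<close>

definition EC :: "nat \<Rightarrow> (bool list \<Rightarrow> bool) \<Rightarrow> real" where
  "EC n f = (INF w\<in>{w. EC_feasible n f w}. Max ((\<lambda>x. \<Sum>i<n. w x i) ` inputs n))"

end

(* Lower bound: the probabilities w_x(i) that a zero-error algorithm queries i on x are feasible,
   since the sets queried by any two correct trees on x and on y, where f x \<noteq> f y, share a position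
   at which x and y differ.

   Upper bound: as long as f is not constant on the inputs consistent with the answers so far, take
   two such inputs y, y' with f y \<noteq> f y' and query a fresh position i with probability proportional
   to w_y(i) + w_y'(i).  The value of f at the input x differs from one of f y, f y', so feasibility
   shows that the w_x-weight of the positions not yet queried drops by at least 1/(2M) in expectation,
   where M is the maximal total weight.  As the weight starts at no more than M, at most 2M^2
   queries are made in expectation. *)

theory Submission
  imports Defs
begin

section \<open>Inputs and correctness of random trees\<close>

lemma finite_inputs: "finite (inputs n)"
  using finite_lists_length_eq[of "UNIV :: bool set" n] by (simp add: inputs_def)

lemma inputs_nonempty: "inputs n \<noteq> {}"
  by (auto simp: inputs_def intro: exI[of _ "replicate n False"])

text \<open>An event has probability 1 under a pmf iff it contains the support. This replaces almost
  sure correctness by correctness of each single tree.\<close>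

lemma zero_error_iff:
  "zero_error n f A \<longleftrightarrow> (\<forall>T\<in>set_pmf A. \<forall>x\<in>inputs n. run T x = f x)"
  by (auto simp: zero_error_def measure_pmf.prob_eq_1 AE_measure_pmf_iff)

section \<open>Query probabilities as feasible weights\<close>

primrec queried :: "dtree \<Rightarrow> bool list \<Rightarrow> nat set" where
  "queried (Output b) x = {}"
| "queried (Query i S T) x = insert i (if x ! i then queried T x else queried S x)"

lemma finite_queried: "finite (queried T x)"
  by (induction T) auto

text \<open>The inequality can be strict, because a path may query the same position
  repeatedly.\<close>

lemma card_queried_le: "card (queried T x) \<le> queries T x"
  by (induction T) (auto intro: le_trans[OF card_insert_le_m1] simp: card_insert_if finite_queried)

lemma queried_subset: "dtree_over n T \<Longrightarrow> queried T x \<subseteq> {..<n}"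
  by (induction T) auto

lemma run_cong: "(\<And>i. i \<in> queried T x \<Longrightarrow> z ! i = x ! i) \<Longrightarrow> run T z = run T x"
  by (induction T) (auto split: if_splits)

text \<open>Otherwise some hybrid input looks like \<open>x\<close> to \<open>T\<close> and like
  \<open>y\<close> to \<open>T'\<close>, so the two trees would give different outputs on it
  although both are correct.\<close>

lemma queried_conflict:
  assumes "dtree_over n T" "dtree_over n T'"
    and "\<forall>x\<in>inputs n. run T x = f x" "\<forall>x\<in>inputs n. run T' x = f x"
    and "x \<in> inputs n" "y \<in> inputs n" "f x \<noteq> f y"
  shows "\<exists>i<n. x ! i \<noteq> y ! i \<and> i \<in> queried T x \<and> i \<in> queried T' y"
proof (rule ccontr)
  assume no: "\<not> ?thesis"
  \<comment> \<open>\<open>z\<close> follows \<open>x\<close> where \<open>T\<close> looks and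
    \<open>y\<close> elsewhere. Where both trees look, \<open>x\<close> and \<open>y\<close> agree
    by \<open>no\<close>, so \<open>z\<close> also matches \<open>y\<close> on all that
    \<open>T'\<close> reads.\<close>
  define z where "z = map (\<lambda>i. if i \<in> queried T x then x ! i else y ! i) [0..<n]"
  have z: "z \<in> inputs n" by (simp add: z_def inputs_def)
  have "run T z = run T x"
    using queried_subset[OF assms(1), of x] by (intro run_cong) (auto simp: z_def subset_iff)
  moreover have "run T' z = run T' y"
    using queried_subset[OF assms(2), of y] no by (intro run_cong) (auto simp: z_def subset_iff)
  ultimately show False using assms z by simp
qed

definition query_prob :: "dtree pmf \<Rightarrow> bool list \<Rightarrow> nat \<Rightarrow> real" where
  "query_prob A x i = measure_pmf.prob A {T. i \<in> queried T x}"

text \<open>Linearity of expectation: the left side is the expected number of distinct positions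
  below \<open>n\<close> that are queried.\<close>

lemma sum_query_prob_le: "ennreal (\<Sum>i<n. query_prob A x i) \<le> expected_queries A x"
proof -
  have "ennreal (\<Sum>i<n. query_prob A x i)
      = (\<Sum>i<n. \<integral>\<^sup>+ T. indicator {T. i \<in> queried T x} T \<partial>measure_pmf A)"
    by (simp add: query_prob_def measure_pmf.emeasure_eq_measure flip: sum_ennreal)
  also have "\<dots> = (\<integral>\<^sup>+ T. (\<Sum>i<n. indicator {T. i \<in> queried T x} T) \<partial>measure_pmf A)"
    by (rule nn_integral_sum[symmetric]) auto
  also have "\<dots> \<le> expected_queries A x"
    unfolding expected_queries_def
  proof (rule nn_integral_mono)
    fix T
    have "(\<Sum>i<n. indicator {T. i \<in> queried T x} T :: ennreal)
        = of_nat (card ({..<n} \<inter> queried T x))"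
      by (simp add: indicator_def sum.If_cases Int_def)
    also have "\<dots> \<le> of_nat (queries T x)"
      using card_queried_le[of T x] card_mono[OF finite_queried, of "{..<n} \<inter> queried T x" T x]
      by (intro of_nat_mono) auto
    finally show "(\<Sum>i<n. indicator {T. i \<in> queried T x} T) \<le> (of_nat (queries T x) :: ennreal)" .
  qed
  finally show ?thesis .
qed

text \<open>For independent draws \<open>T\<close>, \<open>T'\<close> from \<open>A\<close>, the
  product of weights at \<open>i\<close> is the probability that \<open>T\<close> queries
  \<open>i\<close> on \<open>x\<close> and \<open>T'\<close> queries \<open>i\<close> on
  \<open>y\<close>. The constraint says that the expected number of such conflicts is at least 1,
  and there is always one.\<close>

lemma EC_feasible_query_prob:
  assumes A: "A \<in> rand_algs n" and correct: "zero_error n f A"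
  shows "EC_feasible n f (query_prob A)"
  unfolding EC_feasible_def
proof (intro conjI ballI impI allI)
  fix x y assume x: "x \<in> inputs n" and y: "y \<in> inputs n" and ne: "f x \<noteq> f y"
  let ?D = "{i. i < n \<and> x ! i \<noteq> y ! i}"
  \<comment> \<open>With \<open>T\<close> fixed, only \<open>T'\<close> is random: the conflict
    events cover the whole support, so a union bound applies.\<close>
  have tree: "1 \<le> (\<Sum>i\<in>?D. indicator {T. i \<in> queried T x} T * query_prob A y i)"
    if T: "T \<in> set_pmf A" for T
  proof -
    let ?I = "?D \<inter> queried T x"
    have "set_pmf A \<subseteq> (\<Union>i\<in>?I. {T'. i \<in> queried T' y})"
    proof
      fix T' assume T': "T' \<in> set_pmf A"
      have "\<exists>i<n. x ! i \<noteq> y ! i \<and> i \<in> queried T x \<and> i \<in> queried T' y"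
        using A correct T T' x y ne
        by (intro queried_conflict[where f = f]) (auto simp: rand_algs_def zero_error_iff)
      then show "T' \<in> (\<Union>i\<in>?I. {T'. i \<in> queried T' y})" by auto
    qed
    then have "1 = measure_pmf.prob A (\<Union>i\<in>?I. {T'. i \<in> queried T' y})"
      by (subst eq_commute, subst measure_pmf.prob_eq_1) (auto simp: AE_measure_pmf_iff)
    also have "\<dots> \<le> (\<Sum>i\<in>?I. query_prob A y i)"
      unfolding query_prob_def by (intro measure_pmf.finite_measure_subadditive_finite) auto
    also have "\<dots> = (\<Sum>i\<in>?D. indicator {T. i \<in> queried T x} T * query_prob A y i)"
      by (intro sum.mono_neutral_cong_left) (auto simp: indicator_def)
    finally show ?thesis .
  qed
  have int: "integrable (measure_pmf A) (\<lambda>T. indicator {T. i \<in> queried T x} T * query_prob A y i)"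
    for i
    by (intro integrable_mult_left measure_pmf.integrable_const_bound[where B = 1]) auto
  \<comment> \<open>Averaging over \<open>T\<close> turns the indicators into the weights of
    \<open>x\<close>.\<close>
  have "1 \<le> (\<integral>T. (\<Sum>i\<in>?D. indicator {T. i \<in> queried T x} T * query_prob A y i) \<partial>measure_pmf A)"
    using tree int
    by (intro measure_pmf.integral_ge_const Bochner_Integration.integrable_sum)
       (auto simp: AE_measure_pmf_iff)
  also have "\<dots> = (\<Sum>i\<in>?D. query_prob A x i * query_prob A y i)"
    using int by (subst Bochner_Integration.integral_sum) (auto simp: query_prob_def)
  finally show "1 \<le> (\<Sum>i\<in>?D. query_prob A x i * query_prob A y i)" .
qed (auto simp: query_prob_def)

section \<open>\<open>EC\<close> as an infimum, and the lower bound on \<open>R0\<close>\<close>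

lemma sum_le_Max_inputs:
  fixes w :: "bool list \<Rightarrow> nat \<Rightarrow> real"
  shows "x \<in> inputs n \<Longrightarrow> (\<Sum>i<n. w x i) \<le> Max ((\<lambda>x. \<Sum>i<n. w x i) ` inputs n)"
  by (intro Max_ge) (auto simp: finite_inputs)

text \<open>Bounds the objective from below, as the real infimum in \<open>EC\<close>
  requires.\<close>

lemma Max_inputs_nonneg:
  assumes "EC_feasible n f w"
  shows "0 \<le> Max ((\<lambda>x. \<Sum>i<n. w x i) ` inputs n)"
proof -
  obtain x where x: "x \<in> inputs n" using inputs_nonempty by blast
  then have "0 \<le> (\<Sum>i<n. w x i)" using assms by (intro sum_nonneg) (simp add: EC_feasible_def)
  also have "\<dots> \<le> Max ((\<lambda>x. \<Sum>i<n. w x i) ` inputs n)" using x by (rule sum_le_Max_inputs)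
  finally show ?thesis .
qed

text \<open>Inputs with different values differ at some position. Besides making the infimum in
  \<open>EC\<close> range over a nonempty set, this family later shows that \<open>R0\<close> is
  finite.\<close>

lemma EC_feasible_one: "EC_feasible n f (\<lambda>_ _. 1)"
proof -
  have "card {i. i < n \<and> x ! i \<noteq> y ! i} \<ge> 1"
    if xy: "x \<in> inputs n" "y \<in> inputs n" "f x \<noteq> f y" for x y
  proof -
    obtain i where "i < n" "x ! i \<noteq> y ! i"
      using xy nth_equalityI[of x y] by (metis (mono_tags, lifting) inputs_def mem_Collect_eq)
    then show ?thesis by (auto simp: Suc_le_eq card_gt_0_iff)
  qed
  then show ?thesis by (auto simp: EC_feasible_def)
qed

lemma EC_le:
  assumes "EC_feasible n f w" shows "EC n f \<le> Max ((\<lambda>x. \<Sum>i<n. w x i) ` inputs n)"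
  unfolding EC_def
  using assms Max_inputs_nonneg by (intro cINF_lower bdd_belowI2[where m = 0]) auto

lemma le_EC:
  assumes "\<And>w. EC_feasible n f w \<Longrightarrow> c \<le> Max ((\<lambda>x. \<Sum>i<n. w x i) ` inputs n)"
  shows "c \<le> EC n f"
  unfolding EC_def using assms EC_feasible_one by (intro cINF_greatest) auto

lemma EC_le_R0: "ennreal (EC n f) \<le> R0 n f"
  unfolding R0_def
proof (rule INF_greatest)
  fix A assume "A \<in> {A \<in> rand_algs n. zero_error n f A}"
  then have feas: "EC_feasible n f (query_prob A)" by (auto intro: EC_feasible_query_prob)
  let ?s = "\<lambda>x. \<Sum>i<n. query_prob A x i"
  have "Max (?s ` inputs n) \<in> ?s ` inputs n"
    using finite_inputs inputs_nonempty by (intro Max_in) auto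
  then obtain x where x: "x \<in> inputs n" "Max (?s ` inputs n) = ?s x" by auto
  have "ennreal (EC n f) \<le> ennreal (?s x)"
    using EC_le[OF feas] x(2) by (simp add: ennreal_leI)
  also have "\<dots> \<le> expected_queries A x" by (rule sum_query_prob_le)
  also have "\<dots> \<le> (SUP x\<in>inputs n. expected_queries A x)" using x(1) by (rule SUP_upper)
  finally show "ennreal (EC n f) \<le> (SUP x\<in>inputs n. expected_queries A x)" .
qed

section \<open>Upper bound by adaptive sampling of positions\<close>

lemma pmf_proportional:
  fixes v :: "'a \<Rightarrow> real"
  assumes "finite S" "\<And>i. i \<in> S \<Longrightarrow> 0 \<le> v i" "0 < sum v S"
  obtains p where "set_pmf p \<subseteq> S" "\<And>i. i \<in> S \<Longrightarrow> pmf p i = v i / sum v S"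
proof
  define g where "g i = (if i \<in> S then v i / sum v S else 0)" for i
  have nonneg: "0 \<le> g i" for i using assms by (auto simp: g_def)
  have "(\<integral>\<^sup>+ i. ennreal (g i) \<partial>count_space UNIV) = (\<Sum>i\<in>S. ennreal (g i))"
    using assms(1) by (intro nn_integral_count_space') (auto simp: g_def)
  also have "\<dots> = ennreal (\<Sum>i\<in>S. v i / sum v S)"
    using nonneg by (simp add: sum_ennreal) (simp add: g_def)
  also have "\<dots> = 1" using assms(3) by (simp flip: sum_divide_distrib)
  finally have pmf: "pmf (embed_pmf g) i = g i" for i
    using nonneg by (intro pmf_embed_pmf)
  show "set_pmf (embed_pmf g) \<subseteq> S" by (auto simp: set_pmf_iff pmf g_def split: if_splits)
  show "pmf (embed_pmf g) i = v i / sum v S" if "i \<in> S" for i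
    using that by (simp add: pmf g_def)
qed

text \<open>Both subtrees are drawn independently, but only the one selected by \<open>x ! i\<close>
  is run; the draw of the other integrates out to 1.\<close>

lemma expected_queries_Query:
  "expected_queries (do {T0 \<leftarrow> A0; T1 \<leftarrow> A1; return_pmf (Query i T0 T1)}) x
     = 1 + expected_queries (if x ! i then A1 else A0) x"
  by (simp add: expected_queries_def nn_integral_add)

text \<open>\<open>X\<close> is the set of inputs consistent with the answers received so far, and \<open>S\<close> contains the
  positions not yet queried.\<close>

lemma zero_error_alg_exists:
  assumes w: "EC_feasible n f w" and M: "\<And>x. x \<in> inputs n \<Longrightarrow> (\<Sum>i<n. w x i) \<le> M"
    and S: "S \<subseteq> {..<n}" and X: "X \<subseteq> inputs n"
    and agree: "\<And>x y i. x \<in> X \<Longrightarrow> y \<in> X \<Longrightarrow> i < n \<Longrightarrow> i \<notin> S \<Longrightarrow> x ! i = y ! i"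
  shows "\<exists>A\<in>rand_algs n. (\<forall>T\<in>set_pmf A. \<forall>x\<in>X. run T x = f x) \<and>
           (\<forall>x\<in>X. expected_queries A x \<le> ennreal (2 * M * (\<Sum>i\<in>S. w x i)))"
proof -
  have "finite S" using S finite_subset by blast
  then show ?thesis using S X agree
  \<comment> \<open>\<open>X\<close> is generalized because each answer shrinks the set of
    consistent inputs.\<close>
  proof (induction S arbitrary: X rule: finite_psubset_induct)
    case (psubset S)
    note S = \<open>S \<subseteq> {..<n}\<close> and X = \<open>X \<subseteq> inputs n\<close>
    have w01: "0 \<le> w x i" if "x \<in> X" "i \<in> S" for x i
      using w subsetD[OF X that(1)] subsetD[OF S that(2)] by (simp add: EC_feasible_def)
    show ?case
    proof (cases "\<exists>b. \<forall>x\<in>X. f x = b")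
      \<comment> \<open>This includes empty \<open>X\<close>, which arises when no consistent input
        has the given answer.\<close>
      case True
      then obtain b where "\<forall>x\<in>X. f x = b" ..
      then show ?thesis
        by (intro bexI[of _ "return_pmf (Output b)"])
           (auto simp: rand_algs_def expected_queries_def)
    next
      case False
      then obtain y y' where y: "y \<in> X" "y' \<in> X" "f y \<noteq> f y'" by metis
      define v where "v i = w y i + w y' i" for i
      have v_nonneg: "0 \<le> v i" if "i \<in> S" for i using that w01 y by (auto simp: v_def)
      have progress: "1 \<le> (\<Sum>i\<in>S. v i * w x i)" if x: "x \<in> X" for x
      proof -
        \<comment> \<open>\<open>u\<close> is whichever of \<open>y\<close>, \<open>y'\<close> has
          the value opposite to \<open>f x\<close>; \<open>v\<close> dominates its weight since the
          other summand is nonnegative.\<close>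
        obtain u where u: "u \<in> X" "f x \<noteq> f u" "\<And>i. i \<in> S \<Longrightarrow> w u i \<le> v i"
          using y w01 by (cases "f x = f y") (auto simp: v_def)
        let ?D = "{i. i < n \<and> x ! i \<noteq> u ! i}"
        have "?D \<subseteq> S" using psubset.prems(3) x u by blast
        have "1 \<le> (\<Sum>i\<in>?D. w x i * w u i)" using w u(2) subsetD[OF X x] subsetD[OF X u(1)] by (simp add: EC_feasible_def)
        also have "\<dots> \<le> (\<Sum>i\<in>S. w x i * w u i)"
          using \<open>?D \<subseteq> S\<close> w01 x u psubset.hyps by (intro sum_mono2) auto
        also have "\<dots> \<le> (\<Sum>i\<in>S. v i * w x i)"
          using w01 x u(3) by (intro sum_mono) (auto simp: mult.commute intro: mult_right_mono)
        finally show ?thesis .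
      qed
      define V where "V = sum v S"
      have "V \<noteq> 0"
      proof
        assume "V = 0"
        then have "\<forall>i\<in>S. v i = 0"
          using v_nonneg psubset.hyps by (simp add: V_def sum_nonneg_eq_0_iff)
        then show False using progress[OF y(1)] by simp
      qed
      then have V_pos: "0 < V"
        using v_nonneg by (simp add: V_def sum_nonneg order.strict_iff_order)
      have weight: "(\<Sum>i\<in>S. w u i) \<le> M" if "u \<in> X" for u
      proof -
        have "(\<Sum>i\<in>S. w u i) \<le> (\<Sum>i<n. w u i)"
          using w that S X by (intro sum_mono2) (auto simp: EC_feasible_def subset_iff)
        also have "\<dots> \<le> M" using M that X by auto
        finally show ?thesis .
      qed
      then have V_le: "V \<le> 2 * M" 
        using weight[OF y(1)] weight[OF y(2)] by (simp add: V_def v_def sum.distrib)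
      then have M_pos: "0 < M" using V_pos by simp
      obtain p where p: "set_pmf p \<subseteq> S" "\<And>i. i \<in> S \<Longrightarrow> pmf p i = v i / V"
        using pmf_proportional[of S v] psubset.hyps v_nonneg V_pos by (auto simp: V_def)
      \<comment> \<open>The conclusion of the induction hypothesis for one position and one answer,
        named so that a choice function \<open>B\<close> can be extracted.\<close>
      define good where "good i b A \<longleftrightarrow> A \<in> rand_algs n \<and>
        (\<forall>T\<in>set_pmf A. \<forall>x\<in>{x\<in>X. x ! i = b}. run T x = f x) \<and>
        (\<forall>x\<in>{x\<in>X. x ! i = b}. expected_queries A x \<le> ennreal (2 * M * (\<Sum>j\<in>S - {i}. w x j)))"
        for i b A
      \<comment> \<open>Inputs in the restricted set share bit \<open>b\<close> at \<open>i\<close>,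
        so agreement outside \<open>S - {i}\<close> is preserved.\<close>
      have "\<exists>A. good i b A" if "i \<in> S" for i b
        using psubset.IH[of "S - {i}" "{x\<in>X. x ! i = b}"] that S X psubset.prems(3)
        unfolding good_def by blast
      then obtain B where "\<And>i b. i \<in> S \<Longrightarrow> good i b (B i b)" by metis
      then have B:
        "\<And>i b. i \<in> S \<Longrightarrow> B i b \<in> rand_algs n"
        "\<And>i b T x. i \<in> S \<Longrightarrow> T \<in> set_pmf (B i b) \<Longrightarrow> x \<in> X \<Longrightarrow> x ! i = b \<Longrightarrow> run T x = f x"
        "\<And>i x. i \<in> S \<Longrightarrow> x \<in> X \<Longrightarrow>
           expected_queries (B i (x ! i)) x \<le> ennreal (2 * M * (\<Sum>j\<in>S - {i}. w x j))"
        unfolding good_def by blast+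
      define Q where
        "Q i = do {T0 \<leftarrow> B i False; T1 \<leftarrow> B i True; return_pmf (Query i T0 T1)}" for i
      have support: "\<exists>i\<in>S. \<exists>T0\<in>set_pmf (B i False). \<exists>T1\<in>set_pmf (B i True).
          T = Query i T0 T1"
        if "T \<in> set_pmf (p \<bind> Q)" for T
        using that p(1) by (auto simp: Q_def)
      have "expected_queries (p \<bind> Q) x \<le> ennreal (2 * M * (\<Sum>i\<in>S. w x i))" if x: "x \<in> X" for x
      proof -
        let ?W = "\<Sum>i\<in>S. w x i"
        have W: "(\<Sum>j\<in>S - {i}. w x j) = ?W - w x i" if "i \<in> S" for i
          using that psubset.hyps by (simp add: sum_diff1)
        have W_nonneg: "0 \<le> ?W - w x i" if "i \<in> S" for i
          using w01[OF x] unfolding W[OF that, symmetric] by (intro sum_nonneg) auto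
        have cost: "expected_queries (Q i) x \<le> ennreal (1 + 2 * M * (?W - w x i))"
          if "i \<in> S" for i
        proof -
          have "expected_queries (Q i) x = 1 + expected_queries (B i (x ! i)) x"
            unfolding Q_def expected_queries_Query by (cases "x ! i") simp_all
          also have "\<dots> \<le> 1 + ennreal (2 * M * (?W - w x i))"
            using B(3)[OF that x] by (simp add: W[OF that])
          finally show ?thesis using W_nonneg[OF that] M_pos by simp
        qed
        have "expected_queries (p \<bind> Q) x = (\<integral>\<^sup>+ i. expected_queries (Q i) x \<partial>measure_pmf p)"
          by (simp add: expected_queries_def)
        also have "\<dots> = (\<Sum>i\<in>S. expected_queries (Q i) x * ennreal (pmf p i))"
          using p(1) psubset.hyps
          by (intro nn_integral_measure_pmf_support) (auto simp: set_pmf_iff)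
        also have "\<dots> \<le> (\<Sum>i\<in>S. ennreal ((1 + 2 * M * (?W - w x i)) * (v i / V)))"
        proof (rule sum_mono)
          fix i assume i: "i \<in> S"
          have "expected_queries (Q i) x * ennreal (pmf p i)
              \<le> ennreal (1 + 2 * M * (?W - w x i)) * ennreal (v i / V)"
            unfolding p(2)[OF i] using cost[OF i] by (rule mult_right_mono) simp
          also have "\<dots> = ennreal ((1 + 2 * M * (?W - w x i)) * (v i / V))"
            using W_nonneg[OF i] v_nonneg[OF i] M_pos V_pos by (intro ennreal_mult[symmetric]) auto
          finally show "expected_queries (Q i) x * ennreal (pmf p i)
              \<le> ennreal ((1 + 2 * M * (?W - w x i)) * (v i / V))" .
        qed
        also have "\<dots> = ennreal (\<Sum>i\<in>S. (1 + 2 * M * (?W - w x i)) * (v i / V))"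
          using W_nonneg v_nonneg M_pos V_pos by (intro sum_ennreal) auto
        \<comment> \<open>Since \<open>sum v S / V\<close> is 1, the cost is one query plus the old
          budget, minus the expected drop of the budget.\<close>
        also have "(\<Sum>i\<in>S. (1 + 2 * M * (?W - w x i)) * (v i / V))
            = (1 + 2 * M * ?W) * (sum v S / V) - 2 * M / V * (\<Sum>i\<in>S. v i * w x i)"
        proof -
          have "(\<Sum>i\<in>S. (1 + 2 * M * (?W - w x i)) * (v i / V))
              = (\<Sum>i\<in>S. (1 + 2 * M * ?W) * (v i / V) - 2 * M / V * (v i * w x i))"
            by (intro sum.cong refl) (simp add: algebra_simps)
          then show ?thesis
            by (simp add: sum_subtractf flip: sum_distrib_left sum_divide_distrib)
        qed
        also have "\<dots> \<le> 2 * M * ?W"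
        proof -
          \<comment> \<open>The expected drop pays for the query: \<open>2 * M / V\<close> is at
            least 1 by \<open>V_le\<close>, and the sum is at least 1 by
            \<open>progress\<close>.\<close>
          have "1 * 1 \<le> (2 * M / V) * (\<Sum>i\<in>S. v i * w x i)"
            using progress[OF x] V_le V_pos by (intro mult_mono) auto
          then show ?thesis using V_pos by (simp add: V_def[symmetric])
        qed
        finally show ?thesis by (simp add: ennreal_leI)
      qed
      moreover have "p \<bind> Q \<in> rand_algs n"
        unfolding rand_algs_def using support B(1) S by (fastforce simp: rand_algs_def)
      moreover have "run T x = f x" if T: "T \<in> set_pmf (p \<bind> Q)" and x: "x \<in> X" for T x
      proof -
        obtain i T0 T1 where "i \<in> S" "T0 \<in> set_pmf (B i False)" "T1 \<in> set_pmf (B i True)"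
          "T = Query i T0 T1"
          using support[OF T] by blast
        then show ?thesis using B(2)[of i _ "x ! i" x] x by (cases "x ! i") auto
      qed
      ultimately show ?thesis by blast
    qed
  qed
qed

text \<open>Start with nothing queried and all inputs consistent, where the agreement condition is
  vacuous; the initial weight of each input is at most \<open>M\<close>.\<close>

lemma R0_le_square_weight:
  assumes w: "EC_feasible n f w" and M: "\<And>x. x \<in> inputs n \<Longrightarrow> (\<Sum>i<n. w x i) \<le> M"
  shows "R0 n f \<le> ennreal (2 * M\<^sup>2)"
proof -
  have "0 \<le> M"
    using M finite_inputs[of n] inputs_nonempty[of n]
    by (intro order.trans[OF Max_inputs_nonneg[OF w]] Max.boundedI) auto
  obtain A where A: "A \<in> rand_algs n" "\<forall>T\<in>set_pmf A. \<forall>x\<in>inputs n. run T x = f x"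
    "\<forall>x\<in>inputs n. expected_queries A x \<le> ennreal (2 * M * (\<Sum>i<n. w x i))"
    using zero_error_alg_exists[OF w M, of "{..<n}" "inputs n"] by auto
  have "R0 n f \<le> (SUP x\<in>inputs n. expected_queries A x)"
    unfolding R0_def using A by (intro INF_lower) (auto simp: zero_error_iff)
  also have "\<dots> \<le> ennreal (2 * M\<^sup>2)"
  proof (rule SUP_least)
    fix x assume x: "x \<in> inputs n"
    have "expected_queries A x \<le> ennreal (2 * M * (\<Sum>i<n. w x i))" using A(3) x by blast
    also have "\<dots> \<le> ennreal (2 * M\<^sup>2)"
      using M[OF x] \<open>0 \<le> M\<close>
      by (intro ennreal_leI) (auto simp: power2_eq_square mult.assoc intro: mult_left_mono)
    finally show "expected_queries A x \<le> ennreal (2 * M\<^sup>2)" .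
  qed
  finally show ?thesis .
qed

text \<open>The bound holds for each feasible family. To pass to the infimum without a minimizer, it
  is rewritten as a lower bound \<open>sqrt (r / 2)\<close> on every objective value.\<close>

lemma R0_le_EC_square: "R0 n f \<le> ennreal (2 * (EC n f)\<^sup>2)"
proof -
  have bound: "R0 n f \<le> ennreal (2 * (Max ((\<lambda>x. \<Sum>i<n. w x i) ` inputs n))\<^sup>2)"
    if "EC_feasible n f w" for w
    using that sum_le_Max_inputs by (rule R0_le_square_weight)
  \<comment> \<open>Finiteness lets \<open>R0\<close> be treated as a real \<open>r\<close>, so that
    the square root can be taken.\<close>
  have "R0 n f < \<top>"
    using bound[OF EC_feasible_one] by (rule le_less_trans) simp
  then obtain r where r: "0 \<le> r" "R0 n f = ennreal r"
    by (cases "R0 n f") auto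
  have "sqrt (r / 2) \<le> EC n f"
  proof (rule le_EC)
    fix w assume w: "EC_feasible n f w"
    let ?M = "Max ((\<lambda>x. \<Sum>i<n. w x i) ` inputs n)"
    have "r \<le> 2 * ?M\<^sup>2" using bound[OF w] r by (simp add: ennreal_le_iff)
    then show "sqrt (r / 2) \<le> ?M"
      using Max_inputs_nonneg[OF w] by (intro real_le_lsqrt) auto
  qed
  then have "r / 2 \<le> (EC n f)\<^sup>2" using sqrt_le_D by blast
  then show ?thesis using r by (simp add: ennreal_leI)
qed

theorem theorem1:
  "\<exists>K::real. K > 0 \<and>
     (\<forall>n::nat. n \<ge> 1 \<longrightarrow> (\<forall>f :: bool list \<Rightarrow> bool.
        ennreal (EC n f) \<le> R0 n f \<and> R0 n f \<le> ennreal (K * (EC n f)\<^sup>2)))"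
  using EC_le_R0 R0_le_EC_square by (intro exI[of _ 2]) auto

end
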